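(* Let $\alpha\in(0,1)$, $z=z_{\alpha/2}$ and $\tilde L_{NAS}(A)=A^{(1+z^2)/4}$, and let $\hat A^{NAS}$ be defined by $$\hat A^{NAS}=\arg\max_{A>0}\tilde L_{NAS}(A)\,L_{RE}(A|y).$$ Under the regularity conditions R1--R3 and R5 listed in the context: (1) there exists at least one solution $\hat A^{NAS}$ for $A>0$ with the condition $m>p+\frac{1+z^2}{2}$; (2) in the balanced case ($D_i=D$ for all $i$), there is a unique solution $\hat A^{NAS}$ for $A>0$.
   Context: Fay--Herriot model: for $i=1,\dots,m$, $y_i\mid\theta_i\sim N(\theta_i,D_i)$ independently and $\theta_i\sim N(x_i'\beta,A)$ independently, with $D_i$ and $x_i\in\mathbb R^p$ known and $\beta\in\mathbb R^p$, $A$ unknown. Put $y=(y_1,\dots,y_m)'$, $X=(x_1,\dots,x_m)'$, $V=V(A)=\mathrm{diag}(A+D_1,\dots,A+D_m)$, and $h_i=x_i'(X'X)^{-1}x_i$ (the leverage of area $i$). The residual likelihood is $L_{RE}(A|y)=|X'V^{-1}X|^{-1/2}|V|^{-1/2}\exp\{-y'Py/2\}$ with $P=V^{-1}-V^{-1}X(X'V^{-1}X)^{-1}X'V^{-1}$. $z_{\alpha/2}$ is the upper $100(\alpha/2)\%$ point of $N(0,1)$. Regularity conditions: R1: $\mathrm{rank}(X)=p$ is bounded for large $m$. R2: the elements of $X$ are uniformly bounded, implying $\sup_{i\ge1}h_i=O(m^{-1})$. R3: $0<\inf_{i\ge1}D_i\le\sup_{i\ge1}D_i<\infty$, $A\in(0,\infty)$.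 R5: $|\hat A_i|<C_+m^{\lambda}$, where $C_+$ is a generic positive constant, $\lambda$ is a small positive constant, and $\hat A_i=\arg\max_{A>0}\tilde L_{i,ad}(A)L_{RE}(A|y)$ for the adjustment factor $\tilde L_{i,ad}(A)$ in question (here $\tilde L_{i,ad}=\tilde L_{NAS}$, so $\hat A_i=\hat A^{NAS}$).
   Formalization: Part (2) is stated under the condition m > p + (1+z²)/2 of part (1); without it the balanced case fails, since the objective is then strictly increasing in A and has no maximizer (e.g. p=1, x_i=1, D_i=1, α=0.05, m=3). *)

theory Defs
  imports "HOL-Probability.Probability" "Jordan_Normal_Form.DL_Rank"
    "Jordan_Normal_Form.Gauss_Jordan_Elimination"
begin

text \<open>
  The Fay--Herriot data are sequences over all areas: covariates \<open>x i\<close>, sampling variances \<open>D i\<close>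
  and a realization \<open>y i\<close> of the observations; with \<open>m\<close> areas, the initial segment
  \<open>i < m\<close> is used, so that area \<open>i\<close> of the usual \<open>1, \<dots>, m\<close> has index \<open>i - 1\<close>.
\<close>

definition minv :: "real mat \<Rightarrow> real mat" where
  "minv M = the (mat_inverse M)"

definition design_mat :: "nat \<Rightarrow> (nat \<Rightarrow> real Matrix.vec) \<Rightarrow> nat \<Rightarrow> real mat" where
  "design_mat p x m = mat_of_rows p (map x [0..<m])"

definition cov_mat :: "(nat \<Rightarrow> real) \<Rightarrow> nat \<Rightarrow> real \<Rightarrow> real mat" where
  "cov_mat D m A = mat_diag m (\<lambda>i. A + D i)"

definition proj_mat :: "real mat \<Rightarrow> real mat \<Rightarrow> real mat" where
  "proj_mat X V = minv V - minv V * X * minv (X\<^sup>T * minv V * X) * X\<^sup>T * minv V"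

definition residual_likelihood ::
  "nat \<Rightarrow> (nat \<Rightarrow> real Matrix.vec) \<Rightarrow> (nat \<Rightarrow> real) \<Rightarrow> (nat \<Rightarrow> real) \<Rightarrow> nat \<Rightarrow> real \<Rightarrow> real" where
  "residual_likelihood p x D y m A =
    (let X = design_mat p x m; V = cov_mat D m A; yv = Matrix.vec m y in
      Determinant.det (X\<^sup>T * minv V * X) powr (-1/2) * Determinant.det V powr (-1/2)
        * exp (- scalar_prod yv (proj_mat X V *\<^sub>v yv) / 2))"

definition NAS_factor :: "real \<Rightarrow> real \<Rightarrow> real" where
  "NAS_factor z A = A powr ((1 + z\<^sup>2) / 4)"

text \<open>The maximizer need neither exist nor be unique, so it is a predicate on candidates \<open>Ahat\<close>.\<close>

definition is_NAS_estimator ::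
  "real \<Rightarrow> nat \<Rightarrow> (nat \<Rightarrow> real Matrix.vec) \<Rightarrow> (nat \<Rightarrow> real) \<Rightarrow> (nat \<Rightarrow> real) \<Rightarrow> nat \<Rightarrow> real \<Rightarrow> bool" where
  "is_NAS_estimator z p x D y m Ahat \<longleftrightarrow>
    is_arg_max (\<lambda>A. NAS_factor z A * residual_likelihood p x D y m A) (\<lambda>A. A > 0) Ahat"

text \<open>
  The number \<open>p\<close> of covariates does not depend on \<open>m\<close>, hence is bounded; \<open>m0\<close> makes
  ``for large \<open>m\<close>'' explicit, since the rank is necessarily smaller than \<open>p\<close> for \<open>m < p\<close>.
\<close>

definition cond_R1 :: "nat \<Rightarrow> (nat \<Rightarrow> real Matrix.vec) \<Rightarrow> nat \<Rightarrow> bool" where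
  "cond_R1 p x m0 \<longleftrightarrow> (\<forall>m\<ge>m0. vec_space.rank m (design_mat p x m) = p)"

text \<open>
  The bound \<open>O(1/m)\<close> on the leverages, which is meant to be a consequence, is not imposed.
\<close>

definition cond_R2 :: "nat \<Rightarrow> (nat \<Rightarrow> real Matrix.vec) \<Rightarrow> bool" where
  "cond_R2 p x \<longleftrightarrow> (\<exists>B. \<forall>i. \<forall>j<p. \<bar>vec_index (x i) j\<bar> \<le> B)"

text \<open>
  The requirement that the model variance \<open>A\<close> be positive is the range of the maximization
  in \<open>is_NAS_estimator\<close>.
\<close>

definition cond_R3 :: "(nat \<Rightarrow> real) \<Rightarrow> bool" where
  "cond_R3 D \<longleftrightarrow> bdd_below (range D) \<and> 0 < (INF i. D i) \<and> bdd_above (range D)"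

text \<open>
  The growth bound is imposed on every maximizer, for large \<open>m\<close>, and does not itself assert that
  a maximizer exists. (For rank-deficient designs, \<open>0 powr (-1/2) = 0\<close> makes the objective
  vanish identically, so a bound for all \<open>m\<close> could not hold.)
\<close>

definition cond_R5 ::
  "real \<Rightarrow> nat \<Rightarrow> (nat \<Rightarrow> real Matrix.vec) \<Rightarrow> (nat \<Rightarrow> real) \<Rightarrow> (nat \<Rightarrow> real) \<Rightarrow> bool" where
  "cond_R5 z p x D y \<longleftrightarrow>
    (\<exists>C>0. \<exists>lam>0. \<forall>\<^sub>F m in sequentially. \<forall>Ahat.
      is_NAS_estimator z p x D y m Ahat \<longrightarrow> \<bar>Ahat\<bar> < C * real m powr lam)"

end

theory Submission
  imports Defs "HOL-Real_Asymp.Real_Asymp"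
begin

text \<open>
  Write \<open>a = (1 + z\<^sup>2) / 4\<close> and \<open>W = V\<inverse>\<close>, a diagonal matrix with entries \<open>1 / (A + D i)\<close>. Everything
  in the residual likelihood is a function of these weights: the Gram matrix \<open>X' W X\<close>, which is
  positive definite because \<open>X\<close> has full column rank, and \<open>y' P y\<close>, which is the residual sum of
  squares of the weighted least squares fit and hence nonnegative.

  Existence is a compactness argument on the half-line \<open>A \<ge> 0\<close>. As the sampling variances are
  positive, the residual likelihood is continuous up to and including \<open>A = 0\<close>
  (\<open>continuous_on_residual_likelihood\<close>), so the objective extends continuously by \<open>0\<close> there, thanks
  to the factor \<open>A powr a\<close>. At infinity the two determinants behave like \<open>A powr (- p)\<close> and
  \<open>A powr m\<close>, so the objective is at most of order \<open>A powr (a + (p - m) / 2)\<close>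
  (\<open>residual_likelihood_le\<close>); the exponent is negative exactly when \<open>m > p + (1 + z\<^sup>2) / 2\<close>. A
  continuous function that is positive inside and vanishes at both ends attains its maximum.

  In the balanced case the logarithm of the objective is, up to a constant,
  \<open>a * ln A - n * ln (A + d) - s / (A + d)\<close> with \<open>n = (m - p) / 2 > a\<close>. Its critical points are
  roots of a quadratic whose leading coefficient \<open>a - n\<close> and constant term \<open>a * d\<^sup>2\<close> have opposite
  signs, so at most one of them is positive (\<open>score_equation_unique_root\<close>).
\<close>

(* From here on the dot and the dollar sign denote scalar products and entries of vectors whose
   dimension is a number rather than a type. *)
unbundle no inner_syntax
unbundle no vec_syntax

section \<open>Linear algebra\<close>

text \<open>
  The rank counts a maximal independent set of columns, and a matrix with a repeated column has
  fewer than \<open>nc\<close> different columns to choose from.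
\<close>

lemma (in vec_space) full_rank_distinct_cols:
  assumes A: "A \<in> carrier_mat n nc" and rank: "rank A = nc"
  shows "distinct (cols A)"
proof -
  obtain S where S: "maximal S (\<lambda>T. T \<subseteq> set (cols A) \<and> lin_indpt T)"
    using maximal_exists[of "(\<lambda>T. T \<subseteq> set (cols A) \<and> lin_indpt T)" "card (set (cols A))" "{}"]
    by (meson List.finite_set card_mono empty_iff empty_subsetI finite_lin_indpt2 rev_finite_subset)
  have "nc = card S" using rank_card_indpt[OF A S] rank by simp
  also have "\<dots> \<le> card (set (cols A))" using S by (simp add: card_mono maximal_def)
  finally have "length (cols A) \<le> card (set (cols A))" using A by simp
  then show ?thesis by (meson card_distinct card_length le_antisym)
qed

lemma (in vec_space) full_rank_mult_vec_eq_0: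
  assumes A: "A \<in> carrier_mat n nc" and rank: "rank A = nc"
    and v: "v \<in> carrier_vec nc" "A *\<^sub>v v = 0\<^sub>v n"
  shows "v = 0\<^sub>v nc"
  using full_rank_distinct_cols[OF A rank] full_rank_lin_indpt[OF A rank] lin_depI[OF A v(1) _ v(2)]
  by blast

lemma tendsto_det:
  fixes M :: "'b \<Rightarrow> real mat"
  assumes M: "\<And>t. M t \<in> carrier_mat n n" and L: "L \<in> carrier_mat n n"
    and lim: "\<And>i j. i < n \<Longrightarrow> j < n \<Longrightarrow> ((\<lambda>t. M t $$ (i, j)) \<longlongrightarrow> L $$ (i, j)) F"
  shows "((\<lambda>t. Determinant.det (M t)) \<longlongrightarrow> Determinant.det L) F"
  unfolding det_def'[OF M] det_def'[OF L]
  by (intro tendsto_sum tendsto_mult tendsto_const tendsto_prod lim) (auto simp: permutes_def)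

lemma tendsto_cofactor:
  fixes M :: "'b \<Rightarrow> real mat"
  assumes M: "\<And>t. M t \<in> carrier_mat n n" and L: "L \<in> carrier_mat n n"
    and lim: "\<And>i j. i < n \<Longrightarrow> j < n \<Longrightarrow> ((\<lambda>t. M t $$ (i, j)) \<longlongrightarrow> L $$ (i, j)) F"
  shows "((\<lambda>t. cofactor (M t) k l) \<longlongrightarrow> cofactor L k l) F"
  unfolding cofactor_def
proof (intro tendsto_mult tendsto_const tendsto_det[where n = "n - 1"])
  fix i j assume ij: "i < n - 1" "j < n - 1"
  have dims: "dim_row (M t) = n" "dim_col (M t) = n" "dim_row L = n" "dim_col L = n" for t
    using M[of t] L by auto
  show "((\<lambda>t. mat_delete (M t) k l $$ (i, j)) \<longlongrightarrow> mat_delete L k l $$ (i, j)) F"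
    using ij by (auto simp: mat_delete_def dims intro!: lim)
qed (rule mat_delete_carrier, rule M L)+

text \<open>
  The segment from the identity to a positive definite matrix consists of positive definite, hence
  nonsingular, matrices, so the determinant keeps along it the sign that it has at the identity.
\<close>

lemma det_pos_if_positive_definite:
  fixes M :: "real mat"
  assumes M: "M \<in> carrier_mat n n"
    and pos: "\<And>v. v \<in> carrier_vec n \<Longrightarrow> v \<noteq> 0\<^sub>v n \<Longrightarrow> 0 < v \<bullet> (M *\<^sub>v v)"
  shows "0 < Determinant.det M"
proof (rule ccontr)
  assume neg: "\<not> 0 < Determinant.det M"
  define S where "S t = (1 - t) \<cdot>\<^sub>m 1\<^sub>m n + t \<cdot>\<^sub>m M" for t
  have S: "S t \<in> carrier_mat n n" for t using M by (simp add: S_def)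
  have "S 0 = 1\<^sub>m n" "S 1 = M" using M by (auto simp: S_def intro!: eq_matI)
  then have ends: "Determinant.det (S 1) \<le> 0" "0 \<le> Determinant.det (S 0)" using neg by auto
  have "continuous_on {0..1} (\<lambda>t. Determinant.det (S t))"
    unfolding continuous_on
  proof (intro ballI tendsto_det[OF S S])
    fix t i j assume "i < n" "j < n"
    then show "((\<lambda>t. S t $$ (i, j)) \<longlongrightarrow> S t $$ (i, j)) (at t within {0..1})"
      using M by (auto simp: S_def intro!: tendsto_intros)
  qed
  from IVT2'[OF ends _ this] obtain t where t: "0 \<le> t" "t \<le> 1" and "Determinant.det (S t) = 0"
    by auto
  then obtain v where v: "v \<in> carrier_vec n" "v \<noteq> 0\<^sub>v n" and "S t *\<^sub>v v = 0\<^sub>v n"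
    using det_0_iff_vec_prod_zero[OF S] by blast
  then have "0 = v \<bullet> (S t *\<^sub>v v)" by simp
  also have "S t *\<^sub>v v = (1 - t) \<cdot>\<^sub>v v + t \<cdot>\<^sub>v (M *\<^sub>v v)"
    unfolding S_def using M v by (subst add_mult_distrib_mat_vec[of _ n n]) auto
  also have "v \<bullet> \<dots> = (1 - t) * (v \<bullet> v) + t * (v \<bullet> (M *\<^sub>v v))"
    using M v by (subst scalar_prod_add_distrib[of _ n]) auto
  finally have zero: "(1 - t) * (v \<bullet> v) + t * (v \<bullet> (M *\<^sub>v v)) = 0" by simp
  obtain i where "i < n" "v $ i \<noteq> 0" using v by (metis carrier_vecD eq_vecI index_zero_vec)
  then have "0 < v \<bullet> v" using v
    by (auto simp: scalar_prod_def intro!: sum_pos2[of _ i] simp flip: power2_eq_square)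
  with pos[OF v] t have "0 < (1 - t) * (v \<bullet> v) + t * (v \<bullet> (M *\<^sub>v v))"
    by (cases "t = 0") (auto intro!: add_nonneg_pos)
  with zero show False by simp
qed

lemma minv_props:
  assumes M: "M \<in> carrier_mat n n" and det: "Determinant.det M \<noteq> 0"
  shows minv_carrier: "minv M \<in> carrier_mat n n"
    and minv_right: "M * minv M = 1\<^sub>m n" and minv_left: "minv M * M = 1\<^sub>m n"
proof -
  obtain B where "mat_inverse M = Some B"
    using mat_inverse(1)[OF M, where b = "()"] det_non_zero_imp_unit[OF M det, where b = "()"]
    by (cases "mat_inverse M") auto
  with mat_inverse(2)[OF M this]
  show "minv M \<in> carrier_mat n n" "M * minv M = 1\<^sub>m n" "minv M * M = 1\<^sub>m n"
    by (auto simp: minv_def)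
qed

lemma minv_unique:
  assumes M: "M \<in> carrier_mat n n" and B: "B \<in> carrier_mat n n" and MB: "M * B = 1\<^sub>m n"
  shows "minv M = B"
proof -
  have "Determinant.det M * Determinant.det B = 1"
    using det_mult[OF M B] MB by simp
  then have det: "Determinant.det M \<noteq> 0" by auto
  note inv = minv_props[OF M det]
  have "minv M = minv M * (M * B)" using inv(1) MB by simp
  also have "\<dots> = (minv M * M) * B" by (rule assoc_mult_mat[symmetric, OF inv(1) M B])
  also have "\<dots> = B" using inv(3) B by simp
  finally show ?thesis .
qed

lemma minv_eq_adj_mat:
  assumes M: "M \<in> carrier_mat n n" and det: "Determinant.det M \<noteq> 0"
  shows "minv M = (1 / Determinant.det M) \<cdot>\<^sub>m adj_mat M"
  using adj_mat[OF M] det M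
  by (intro minv_unique[OF M])
    (auto simp: mult_smult_distrib[OF M adj_mat(1)[OF M]] intro!: eq_matI)

lemma minv_smult:
  assumes M: "M \<in> carrier_mat n n" and det: "Determinant.det M \<noteq> 0" and c: "c \<noteq> 0"
  shows "minv (c \<cdot>\<^sub>m M) = (1 / c) \<cdot>\<^sub>m minv M"
proof (rule minv_unique)
  note inv = minv_props[OF M det]
  have "(c \<cdot>\<^sub>m M) * ((1 / c) \<cdot>\<^sub>m minv M) = (1 / c) \<cdot>\<^sub>m (c \<cdot>\<^sub>m (M * minv M))"
    using M inv(1) by (simp add: mult_smult_distrib[of _ n n _ n] mult_smult_assoc_mat[of _ n n _ n])
  then show "(c \<cdot>\<^sub>m M) * ((1 / c) \<cdot>\<^sub>m minv M) = 1\<^sub>m n"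
    using inv(2) c by (auto intro!: eq_matI)
qed (use M minv_carrier[OF M det] in auto)

lemma minv_mat_diag:
  assumes "\<And>i. i < n \<Longrightarrow> f i \<noteq> 0"
  shows "minv (mat_diag n f) = mat_diag n (\<lambda>i. 1 / f i)"
proof (rule minv_unique)
  show "mat_diag n f * mat_diag n (\<lambda>i. 1 / f i) = 1\<^sub>m n"
    unfolding mat_diag_diag using assms by (auto simp: mat_diag_def intro!: eq_matI)
qed auto

lemma det_mat_diag: "Determinant.det (mat_diag n f) = (\<Prod>i<n. f i)"
  by (subst det_lower_triangular[of n])
    (auto simp: mat_diag_def prod_list_diag_prod atLeast0LessThan)

lemma mat_diag_mult_vec_carrier: "mat_diag n w *\<^sub>v v \<in> carrier_vec n"
  by (rule carrier_vecI) (simp add: mat_diag_def)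

lemma index_mat_diag_mult_vec:
  assumes "v \<in> carrier_vec n" "i < n"
  shows "(mat_diag n w *\<^sub>v v) $ i = w i * v $ i"
proof -
  have "(mat_diag n w *\<^sub>v v) $ i = (\<Sum>j<n. (if i = j then w j else 0) * v $ j)"
    using assms by (simp add: mat_diag_def scalar_prod_def atLeast0LessThan)
  also have "\<dots> = (\<Sum>j<n. if i = j then w j * v $ j else 0)" by (rule sum.cong) auto
  finally show ?thesis using assms by simp
qed

section \<open>Weighted least squares\<close>

definition weighted_gram :: "real mat \<Rightarrow> (nat \<Rightarrow> real) \<Rightarrow> real mat" where
  "weighted_gram X w = X\<^sup>T * mat_diag (dim_row X) w * X"

text \<open>
  This is \<open>y' P y\<close> for \<open>P = W - W X (X' W X)\<inverse> X' W\<close>, written with the vector \<open>u = X' W y\<close> so that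
  only the inverse of the Gram matrix is left to control.
\<close>

definition weighted_rss :: "real mat \<Rightarrow> (nat \<Rightarrow> real) \<Rightarrow> real vec \<Rightarrow> real" where
  "weighted_rss X w y =
    (let W = mat_diag (dim_row X) w; u = X\<^sup>T *\<^sub>v (W *\<^sub>v y) in
      y \<bullet> (W *\<^sub>v y) - u \<bullet> (minv (weighted_gram X w) *\<^sub>v u))"

lemma weighted_gram_carrier:
  "X \<in> carrier_mat m p \<Longrightarrow> weighted_gram X w \<in> carrier_mat p p"
  unfolding weighted_gram_def by auto

lemma index_weighted_gram:
  assumes X: "X \<in> carrier_mat m p" and "j < p" "k < p"
  shows "weighted_gram X w $$ (j, k) = (\<Sum>i<m. w i * X $$ (i, j) * X $$ (i, k))"
proof -
  have "X\<^sup>T * mat_diag m w = mat p m (\<lambda>(j, i). X $$ (i, j) * w i)"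
    using X by (subst mat_diag_mult_right[of _ p]) (auto intro!: eq_matI)
  then show ?thesis
    using assms by (simp add: weighted_gram_def scalar_prod_def atLeast0LessThan ac_simps)
qed

lemma mat_diag_symmetric:
  fixes v u :: "'a :: comm_ring_1 vec"
  assumes v: "v \<in> carrier_vec n" and u: "u \<in> carrier_vec n"
  shows "v \<bullet> (mat_diag n w *\<^sub>v u) = (mat_diag n w *\<^sub>v v) \<bullet> u"
proof -
  have "v \<bullet> (mat_diag n w *\<^sub>v u) = (\<Sum>i<n. v $ i * (mat_diag n w *\<^sub>v u) $ i)"
    using mat_diag_mult_vec_carrier[of n w u]
    by (simp only: scalar_prod_def carrier_vecD atLeast0LessThan)
  also have "\<dots> = (\<Sum>i<n. (mat_diag n w *\<^sub>v v) $ i * u $ i)"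
    by (intro sum.cong) (simp_all only: lessThan_iff index_mat_diag_mult_vec[OF v]
        index_mat_diag_mult_vec[OF u] mult.commute mult.left_commute)
  also have "\<dots> = (mat_diag n w *\<^sub>v v) \<bullet> u"
    using u by (simp only: scalar_prod_def carrier_vecD atLeast0LessThan)
  finally show ?thesis .
qed

lemma scalar_prod_mat_diag:
  fixes v :: "'a :: comm_ring_1 vec"
  assumes v: "v \<in> carrier_vec n"
  shows "v \<bullet> (mat_diag n w *\<^sub>v v) = (\<Sum>i<n. w i * (v $ i)\<^sup>2)"
proof -
  have "v \<bullet> (mat_diag n w *\<^sub>v v) = (\<Sum>i<n. v $ i * (mat_diag n w *\<^sub>v v) $ i)"
    using mat_diag_mult_vec_carrier[of n w v]
    by (simp only: scalar_prod_def carrier_vecD atLeast0LessThan)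
  also have "\<dots> = (\<Sum>i<n. w i * (v $ i)\<^sup>2)"
    by (intro sum.cong) (simp_all only: lessThan_iff index_mat_diag_mult_vec[OF v]
        power2_eq_square mult.left_commute)
  finally show ?thesis .
qed

lemma weighted_gram_mult_vec:
  assumes X: "X \<in> carrier_mat m p" and v: "v \<in> carrier_vec p"
  shows "weighted_gram X w *\<^sub>v v = X\<^sup>T *\<^sub>v (mat_diag m w *\<^sub>v (X *\<^sub>v v))"
proof -
  have "X\<^sup>T * mat_diag m w \<in> carrier_mat p m" using X by auto
  then show ?thesis
    using X v assoc_mult_mat_vec[of "X\<^sup>T" p m "mat_diag m w" m "X *\<^sub>v v"]
    by (auto simp: weighted_gram_def assoc_mult_mat_vec[of _ p m _ p])
qed

lemma det_weighted_gram_pos: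
  assumes X: "X \<in> carrier_mat m p" and rank: "vec_space.rank m X = p"
    and w: "\<And>i. i < m \<Longrightarrow> 0 < w i"
  shows "0 < Determinant.det (weighted_gram X w)"
proof (rule det_pos_if_positive_definite[OF weighted_gram_carrier[OF X]])
  fix v :: "real vec" assume v: "v \<in> carrier_vec p" "v \<noteq> 0\<^sub>v p"
  have Xv: "X *\<^sub>v v \<in> carrier_vec m" using X v by auto
  have "X *\<^sub>v v \<noteq> 0\<^sub>v m" using vec_space.full_rank_mult_vec_eq_0[OF X rank v(1)] v(2) by blast
  then obtain i where i: "i < m" "(X *\<^sub>v v) $ i \<noteq> 0"
    using Xv by (metis carrier_vecD eq_vecI index_zero_vec)
  have WXv: "mat_diag m w *\<^sub>v (X *\<^sub>v v) \<in> carrier_vec m" by (rule mat_diag_mult_vec_carrier)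
  have "v \<bullet> (weighted_gram X w *\<^sub>v v) = (X\<^sup>T *\<^sub>v (mat_diag m w *\<^sub>v (X *\<^sub>v v))) \<bullet> v"
    using X v WXv by (simp add: weighted_gram_mult_vec comm_scalar_prod[of v p])
  also have "\<dots> = (mat_diag m w *\<^sub>v (X *\<^sub>v v)) \<bullet> (X *\<^sub>v v)"
    by (rule transpose_vec_mult_scalar[OF X v(1) WXv])
  also have "\<dots> = (\<Sum>i<m. w i * ((X *\<^sub>v v) $ i)\<^sup>2)"
    by (simp only: scalar_prod_mat_diag[OF Xv] flip: mat_diag_symmetric[OF Xv Xv])
  also have "\<dots> > 0"
    using w i by (intro sum_pos2[of _ i]) (auto simp: less_imp_le)
  finally show "0 < v \<bullet> (weighted_gram X w *\<^sub>v v)" .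
qed

lemma scalar_prod_proj_mat:
  assumes X: "X \<in> carrier_mat m p" and y: "y \<in> carrier_vec m"
    and v: "\<And>i. i < m \<Longrightarrow> v i \<noteq> 0"
    and det: "Determinant.det (weighted_gram X (\<lambda>i. 1 / v i)) \<noteq> 0"
  shows "y \<bullet> (proj_mat X (mat_diag m v) *\<^sub>v y) = weighted_rss X (\<lambda>i. 1 / v i) y"
proof -
  define W where "W = mat_diag m (\<lambda>i. 1 / v i)"
  define H where "H = minv (weighted_gram X (\<lambda>i. 1 / v i))"
  define u where "u = X\<^sup>T *\<^sub>v (W *\<^sub>v y)"
  have W: "W \<in> carrier_mat m m" by (simp add: W_def)
  have H: "H \<in> carrier_mat p p"
    unfolding H_def by (rule minv_carrier[OF weighted_gram_carrier[OF X] det])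
  have u: "u \<in> carrier_vec p" using X W y by (simp add: u_def)
  have "proj_mat X (mat_diag m v) = W - W * X * H * X\<^sup>T * W"
    using X by (simp add: proj_mat_def minv_mat_diag[OF v] W_def H_def weighted_gram_def)
  also have "\<dots> *\<^sub>v y = W *\<^sub>v y - (W * X * H * X\<^sup>T * W) *\<^sub>v y"
    using X W H y by (intro minus_mult_distrib_mat_vec[of _ m m]) auto
  also have "(W * X * H * X\<^sup>T * W) *\<^sub>v y = (W * X * H * X\<^sup>T) *\<^sub>v (W *\<^sub>v y)"
    using X W H y by (intro assoc_mult_mat_vec[of _ m m _ m]) auto
  also have "\<dots> = (W * X * H) *\<^sub>v u"
    unfolding u_def using X W H y by (intro assoc_mult_mat_vec[of _ m p _ m]) auto
  also have "\<dots> = (W * X) *\<^sub>v (H *\<^sub>v u)"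
    using X W H u by (intro assoc_mult_mat_vec[of _ m p _ p]) auto
  also have "\<dots> = W *\<^sub>v (X *\<^sub>v (H *\<^sub>v u))"
    using X W H u by (intro assoc_mult_mat_vec[of _ m m _ p]) auto
  also have "y \<bullet> (W *\<^sub>v y - \<dots>) = y \<bullet> (W *\<^sub>v y) - y \<bullet> (W *\<^sub>v (X *\<^sub>v (H *\<^sub>v u)))"
    using X W H u y by (intro scalar_prod_minus_distrib[of _ m]) auto
  also have "y \<bullet> (W *\<^sub>v (X *\<^sub>v (H *\<^sub>v u))) = (W *\<^sub>v y) \<bullet> (X *\<^sub>v (H *\<^sub>v u))"
    unfolding W_def using X H u y by (intro mat_diag_symmetric) auto
  also have "\<dots> = u \<bullet> (H *\<^sub>v u)"
    unfolding u_def
    using X W H u y by (intro transpose_vec_mult_scalar[symmetric, of _ m p]) auto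
  finally show ?thesis
    using X by (simp add: weighted_rss_def Let_def W_def H_def u_def)
qed

text \<open>
  The quadratic form is a genuine residual sum of squares: it equals \<open>\<Sum>i. w i * (e $ i)\<^sup>2\<close> for the
  residual \<open>e\<close> of the weighted least squares fit, because \<open>e\<close> satisfies the normal equations.
\<close>

lemma weighted_rss_nonneg:
  assumes X: "X \<in> carrier_mat m p" and y: "y \<in> carrier_vec m"
    and w: "\<And>i. i < m \<Longrightarrow> 0 \<le> w i"
    and det: "Determinant.det (weighted_gram X w) \<noteq> 0"
  shows "0 \<le> weighted_rss X w y"
proof -
  define W where "W = mat_diag m w"
  define G where "G = weighted_gram X w"
  define u where "u = X\<^sup>T *\<^sub>v (W *\<^sub>v y)"
  define b where "b = minv G *\<^sub>v u"
  define e where "e = y - X *\<^sub>v b"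
  have W: "W \<in> carrier_mat m m" by (simp add: W_def)
  have G: "G \<in> carrier_mat p p" unfolding G_def by (rule weighted_gram_carrier[OF X])
  note inv = minv_props[OF G det[folded G_def]]
  have u: "u \<in> carrier_vec p" using X W y by (simp add: u_def)
  have b: "b \<in> carrier_vec p" using inv(1) u by (simp add: b_def)
  have Xb: "X *\<^sub>v b \<in> carrier_vec m" using X b by auto
  have e: "e \<in> carrier_vec m" using y Xb by (simp add: e_def)
  have "G *\<^sub>v b = (G * minv G) *\<^sub>v u"
    unfolding b_def by (rule assoc_mult_mat_vec[symmetric, OF G inv(1) u])
  then have Gb: "G *\<^sub>v b = u" using inv(2) u by simp
  have "X\<^sup>T *\<^sub>v (W *\<^sub>v e) = X\<^sup>T *\<^sub>v (W *\<^sub>v y - W *\<^sub>v (X *\<^sub>v b))"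
    unfolding e_def using W y Xb by (subst mult_minus_distrib_mat_vec[of _ m m]) auto
  also have "\<dots> = u - X\<^sup>T *\<^sub>v (W *\<^sub>v (X *\<^sub>v b))"
    unfolding u_def using X W y Xb by (subst mult_minus_distrib_mat_vec[of _ p m]) auto
  also have "X\<^sup>T *\<^sub>v (W *\<^sub>v (X *\<^sub>v b)) = u"
    using Gb weighted_gram_mult_vec[OF X b, of w] by (simp add: G_def W_def)
  finally have normal: "X\<^sup>T *\<^sub>v (W *\<^sub>v e) = 0\<^sub>v p" using u by simp
  have "0 \<le> (\<Sum>i<m. w i * (e $ i)\<^sup>2)" using w by (intro sum_nonneg) auto
  also have "\<dots> = e \<bullet> (W *\<^sub>v e)" unfolding W_def by (rule scalar_prod_mat_diag[OF e, symmetric])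
  also have "\<dots> = (W *\<^sub>v e) \<bullet> e" unfolding W_def by (rule mat_diag_symmetric[OF e e])
  also have "\<dots> = (W *\<^sub>v e) \<bullet> y - (W *\<^sub>v e) \<bullet> (X *\<^sub>v b)"
    unfolding e_def using W e y Xb by (intro scalar_prod_minus_distrib[of _ m]) auto
  also have "(W *\<^sub>v e) \<bullet> (X *\<^sub>v b) = (X\<^sup>T *\<^sub>v (W *\<^sub>v e)) \<bullet> b"
    using W e by (intro transpose_vec_mult_scalar[OF X b, symmetric]) auto
  also have "\<dots> = 0" using normal b by simp
  also have "(W *\<^sub>v e) \<bullet> y = e \<bullet> (W *\<^sub>v y)"
    unfolding W_def by (rule mat_diag_symmetric[OF e y, symmetric])
  also have "\<dots> = y \<bullet> (W *\<^sub>v y) - (X *\<^sub>v b) \<bullet> (W *\<^sub>v y)"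
    unfolding e_def using W y Xb by (intro minus_scalar_prod_distrib[of _ m]) auto
  also have "(X *\<^sub>v b) \<bullet> (W *\<^sub>v y) = (W *\<^sub>v y) \<bullet> (X *\<^sub>v b)"
    using W y Xb by (intro comm_scalar_prod[of _ m]) auto
  also have "\<dots> = u \<bullet> b"
    unfolding u_def using W y by (intro transpose_vec_mult_scalar[OF X b, symmetric]) auto
  finally show ?thesis
    using X by (simp add: weighted_rss_def Let_def W_def G_def u_def b_def)
qed

text \<open>
  Only the weights of the \<open>m\<close> areas in the sample matter, although weights are given as sequences.
\<close>

lemma weighted_gram_cong:
  assumes X: "X \<in> carrier_mat m p" and "\<And>i. i < m \<Longrightarrow> w i = w' i"
  shows "weighted_gram X w = weighted_gram X w'"
proof -
  have "mat_diag m w = mat_diag m w'" using assms by (auto simp: mat_diag_def intro!: eq_matI)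
  then show ?thesis using X by (simp add: weighted_gram_def)
qed

lemma weighted_rss_cong:
  assumes X: "X \<in> carrier_mat m p" and eq: "\<And>i. i < m \<Longrightarrow> w i = w' i"
  shows "weighted_rss X w y = weighted_rss X w' y"
proof -
  have "mat_diag m w = mat_diag m w'" using assms by (auto simp: mat_diag_def intro!: eq_matI)
  then show ?thesis using X weighted_gram_cong[OF X eq] by (simp add: weighted_rss_def)
qed

lemma weighted_gram_scale:
  assumes X: "X \<in> carrier_mat m p"
  shows "weighted_gram X (\<lambda>i. c * w i) = c \<cdot>\<^sub>m weighted_gram X w"
  using weighted_gram_carrier[OF X]
  by (auto intro!: eq_matI simp: index_weighted_gram[OF X] sum_distrib_left ac_simps
      carrier_matD[OF weighted_gram_carrier[OF X]])

lemma det_weighted_gram_scale: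
  assumes X: "X \<in> carrier_mat m p"
  shows "Determinant.det (weighted_gram X (\<lambda>i. c * w i)) = c ^ p * Determinant.det (weighted_gram X w)"
  using weighted_gram_carrier[OF X, of w] by (simp add: weighted_gram_scale[OF X])

lemma weighted_rss_scale:
  assumes X: "X \<in> carrier_mat m p" and y: "y \<in> carrier_vec m" and c: "c \<noteq> 0"
    and det: "Determinant.det (weighted_gram X w) \<noteq> 0"
  shows "weighted_rss X (\<lambda>i. c * w i) y = c * weighted_rss X w y"
proof -
  define W where "W = mat_diag m w"
  define H where "H = minv (weighted_gram X w)"
  define u where "u = X\<^sup>T *\<^sub>v (W *\<^sub>v y)"
  have W: "W \<in> carrier_mat m m" by (simp add: W_def)
  have H: "H \<in> carrier_mat p p"
    unfolding H_def by (rule minv_carrier[OF weighted_gram_carrier[OF X] det])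
  have u: "u \<in> carrier_vec p" using X W y by (simp add: u_def)
  have "mat_diag m (\<lambda>i. c * w i) = c \<cdot>\<^sub>m W" by (auto simp: W_def mat_diag_def intro!: eq_matI)
  then have Wy: "mat_diag m (\<lambda>i. c * w i) *\<^sub>v y = c \<cdot>\<^sub>v (W *\<^sub>v y)" using W y by auto
  then have cu: "X\<^sup>T *\<^sub>v (mat_diag m (\<lambda>i. c * w i) *\<^sub>v y) = c \<cdot>\<^sub>v u"
    unfolding u_def using X W y by (simp add: mult_mat_vec[of _ p m])
  have "minv (weighted_gram X (\<lambda>i. c * w i)) = (1 / c) \<cdot>\<^sub>m H"
    unfolding H_def weighted_gram_scale[OF X]
    by (rule minv_smult[OF weighted_gram_carrier[OF X] det c])
  moreover have "((1 / c) \<cdot>\<^sub>m H) *\<^sub>v (c \<cdot>\<^sub>v u) = H *\<^sub>v u"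
  proof -
    have "((1 / c) \<cdot>\<^sub>m H) *\<^sub>v (c \<cdot>\<^sub>v u) = c \<cdot>\<^sub>v (((1 / c) \<cdot>\<^sub>m H) *\<^sub>v u)"
      using H u by (intro mult_mat_vec[of _ p p]) auto
    then show ?thesis using H u c by (auto intro!: eq_vecI)
  qed
  ultimately have "weighted_rss X (\<lambda>i. c * w i) y = y \<bullet> (c \<cdot>\<^sub>v (W *\<^sub>v y)) - (c \<cdot>\<^sub>v u) \<bullet> (H *\<^sub>v u)"
    using X by (simp add: weighted_rss_def Let_def cu[unfolded Wy] Wy)
  also have "\<dots> = c * (y \<bullet> (W *\<^sub>v y) - u \<bullet> (H *\<^sub>v u))"
    using W H u y by (simp add: right_diff_distrib)
  finally show ?thesis
    using X by (simp add: weighted_rss_def Let_def W_def H_def u_def)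
qed

lemma tendsto_weighted_gram:
  assumes X: "X \<in> carrier_mat m p" and w: "\<And>i. i < m \<Longrightarrow> ((\<lambda>t. w t i) \<longlongrightarrow> w' i) F"
    and "j < p" "k < p"
  shows "((\<lambda>t. weighted_gram X (w t) $$ (j, k)) \<longlongrightarrow> weighted_gram X w' $$ (j, k)) F"
  unfolding index_weighted_gram[OF X assms(3,4)] by (auto intro!: tendsto_intros w)

lemma tendsto_det_weighted_gram:
  assumes X: "X \<in> carrier_mat m p" and w: "\<And>i. i < m \<Longrightarrow> ((\<lambda>t. w t i) \<longlongrightarrow> w' i) F"
  shows "((\<lambda>t. Determinant.det (weighted_gram X (w t))) \<longlongrightarrow> Determinant.det (weighted_gram X w')) F"
  by (intro tendsto_det[where n = p] weighted_gram_carrier[OF X] tendsto_weighted_gram[OF X w])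

text \<open>
  By Cramer's rule the inverse Gram matrix depends rationally on the weights, and the denominator
  is the determinant of the Gram matrix. Continuity in the weights is read off from this form.
\<close>

lemma weighted_rss_explicit:
  assumes X: "X \<in> carrier_mat m p" and y: "y \<in> carrier_vec m"
    and det: "Determinant.det (weighted_gram X w) \<noteq> 0"
  shows "weighted_rss X w y = (\<Sum>i<m. w i * (y $ i)\<^sup>2) -
    (\<Sum>j<p. (\<Sum>i<m. X $$ (i, j) * (w i * y $ i)) *
      (\<Sum>k<p. cofactor (weighted_gram X w) k j / Determinant.det (weighted_gram X w) *
        (\<Sum>i<m. X $$ (i, k) * (w i * y $ i))))"
proof -
  define G where "G = weighted_gram X w"
  have G: "G \<in> carrier_mat p p" unfolding G_def by (rule weighted_gram_carrier[OF X])
  define u where "u = X\<^sup>T *\<^sub>v (mat_diag m w *\<^sub>v y)"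
  have Wy: "mat_diag m w *\<^sub>v y \<in> carrier_vec m" by (rule mat_diag_mult_vec_carrier)
  have u: "u \<in> carrier_vec p"
    unfolding u_def using X Wy by (intro mult_mat_vec_carrier[of _ p m]) auto
  have "(X\<^sup>T *\<^sub>v v) $ j = (\<Sum>i<m. X $$ (i, j) * v $ i)" if "j < p" "v \<in> carrier_vec m" for v j
    using X that by (simp add: scalar_prod_def atLeast0LessThan)
  from this[OF _ Wy] have uj: "u $ j = (\<Sum>i<m. X $$ (i, j) * (w i * y $ i))" if "j < p" for j
    using that y by (simp add: u_def index_mat_diag_mult_vec del: index_mult_mat_vec)
  have H: "minv G = (1 / Determinant.det G) \<cdot>\<^sub>m adj_mat G"
    by (rule minv_eq_adj_mat[OF G det[folded G_def]])
  have "(minv G *\<^sub>v u) $ j = (\<Sum>k<p. cofactor G k j / Determinant.det G * u $ k)" if "j < p" for j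
    using that G u by (simp add: H adj_mat_def scalar_prod_def atLeast0LessThan)
  moreover have "dim_vec (minv G *\<^sub>v u) = p"
    using minv_carrier[OF G det[folded G_def]] by simp
  ultimately have "u \<bullet> (minv G *\<^sub>v u) =
      (\<Sum>j<p. u $ j * (\<Sum>k<p. cofactor G k j / Determinant.det G * u $ k))"
    by (simp add: scalar_prod_def atLeast0LessThan del: index_mult_mat_vec dim_mult_mat_vec)
  also have "\<dots> = (\<Sum>j<p. (\<Sum>i<m. X $$ (i, j) * (w i * y $ i)) *
      (\<Sum>k<p. cofactor G k j / Determinant.det G * (\<Sum>i<m. X $$ (i, k) * (w i * y $ i))))"
    by (simp add: uj)
  finally show ?thesis
    using X y by (simp add: weighted_rss_def Let_def u_def G_def scalar_prod_mat_diag)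
qed

lemma tendsto_weighted_rss:
  assumes X: "X \<in> carrier_mat m p" and y: "y \<in> carrier_vec m"
    and w: "\<And>i. i < m \<Longrightarrow> ((\<lambda>t. w t i) \<longlongrightarrow> w' i) F"
    and det: "Determinant.det (weighted_gram X w') \<noteq> 0"
  shows "((\<lambda>t. weighted_rss X (w t) y) \<longlongrightarrow> weighted_rss X w' y) F"
proof -
  note lim_det = tendsto_det_weighted_gram[OF X w]
  have "\<forall>\<^sub>F t in F. Determinant.det (weighted_gram X (w t)) \<noteq> 0"
    by (rule tendsto_imp_eventually_ne[OF lim_det det])
  then have ev: "\<forall>\<^sub>F t in F. (\<Sum>i<m. w t i * (y $ i)\<^sup>2) -
      (\<Sum>j<p. (\<Sum>i<m. X $$ (i, j) * (w t i * y $ i)) *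
        (\<Sum>k<p. cofactor (weighted_gram X (w t)) k j / Determinant.det (weighted_gram X (w t)) *
          (\<Sum>i<m. X $$ (i, k) * (w t i * y $ i)))) = weighted_rss X (w t) y"
    by eventually_elim (simp add: weighted_rss_explicit[OF X y])
  show ?thesis
    unfolding weighted_rss_explicit[OF X y det]
    by (rule Lim_transform_eventually[OF _ ev])
      (auto intro!: tendsto_intros w lim_det det tendsto_cofactor[where n = p]
        weighted_gram_carrier[OF X] tendsto_weighted_gram[OF X w])
qed

section \<open>The residual likelihood as a function of the model variance\<close>

lemma design_mat_carrier: "design_mat p x m \<in> carrier_mat m p"
  using mat_of_rows_carrier(1)[of p "map x [0..<m]"] by (simp add: design_mat_def)

text \<open>
  The formula also makes sense at \<open>A = 0\<close>, since the sampling variances are positive; this is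
  what extends the objective continuously to the boundary of the parameter space.
\<close>

lemma residual_likelihood_eq:
  assumes rank: "vec_space.rank m (design_mat p x m) = p"
    and pos: "\<And>i. i < m \<Longrightarrow> 0 < A + D i"
  shows "residual_likelihood p x D y m A =
    Determinant.det (weighted_gram (design_mat p x m) (\<lambda>i. 1 / (A + D i))) powr (-1/2)
      * (\<Prod>i<m. A + D i) powr (-1/2)
      * exp (- weighted_rss (design_mat p x m) (\<lambda>i. 1 / (A + D i)) (vec m y) / 2)"
proof -
  define X where "X = design_mat p x m"
  have X: "X \<in> carrier_mat m p" unfolding X_def by (rule design_mat_carrier)
  have "minv (cov_mat D m A) = mat_diag m (\<lambda>i. 1 / (A + D i))"
    unfolding cov_mat_def using pos by (intro minv_mat_diag) force
  then have gram: "X\<^sup>T * minv (cov_mat D m A) * X = weighted_gram X (\<lambda>i. 1 / (A + D i))"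
    using X by (simp add: weighted_gram_def)
  have "Determinant.det (weighted_gram X (\<lambda>i. 1 / (A + D i))) > 0"
    using pos by (intro det_weighted_gram_pos[OF X rank[folded X_def]]) auto
  then have "vec m y \<bullet> (proj_mat X (cov_mat D m A) *\<^sub>v vec m y) =
      weighted_rss X (\<lambda>i. 1 / (A + D i)) (vec m y)"
    unfolding cov_mat_def using pos by (intro scalar_prod_proj_mat[OF X]) force+
  then show ?thesis
    by (simp add: residual_likelihood_def Let_def gram flip: X_def)
      (simp add: cov_mat_def det_mat_diag)
qed

lemma residual_likelihood_pos:
  assumes rank: "vec_space.rank m (design_mat p x m) = p"
    and pos: "\<And>i. i < m \<Longrightarrow> 0 < A + D i"
  shows "0 < residual_likelihood p x D y m A"
proof -
  have "0 < Determinant.det (weighted_gram (design_mat p x m) (\<lambda>i. 1 / (A + D i)))"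
    using pos by (intro det_weighted_gram_pos[OF design_mat_carrier rank]) auto
  moreover have "A + D i \<noteq> 0" if "i < m" for i using pos[OF that] by simp
  ultimately show ?thesis by (auto simp: residual_likelihood_eq[OF rank pos] intro!: mult_pos_pos)
qed

lemma continuous_on_residual_likelihood:
  assumes rank: "vec_space.rank m (design_mat p x m) = p"
    and D: "\<And>i. i < m \<Longrightarrow> 0 < D i"
  shows "continuous_on {0..} (residual_likelihood p x D y m)"
  unfolding continuous_on
proof
  fix A :: real assume "A \<in> {0..}"
  then have A: "0 \<le> A" by simp
  then have pos: "0 < A + D i" if "i < m" for i using D[OF that] by simp
  let ?F = "at A within {0..}"
  let ?X = "design_mat p x m"
  have lim: "((\<lambda>B. B + D i) \<longlongrightarrow> A + D i) ?F" for i by (intro tendsto_intros)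
  have w: "((\<lambda>B. 1 / (B + D i)) \<longlongrightarrow> 1 / (A + D i)) ?F" if "i < m" for i
    using pos[OF that] by (intro tendsto_divide tendsto_const lim) simp
  have det: "0 < Determinant.det (weighted_gram ?X (\<lambda>i. 1 / (A + D i)))"
    using pos by (intro det_weighted_gram_pos[OF design_mat_carrier rank]) auto
  have prod: "0 < (\<Prod>i<m. A + D i)" using pos by (intro prod_pos) auto
  define L where "L B = Determinant.det (weighted_gram ?X (\<lambda>i. 1 / (B + D i))) powr (-1/2)
    * (\<Prod>i<m. B + D i) powr (-1/2)
    * exp (- weighted_rss ?X (\<lambda>i. 1 / (B + D i)) (vec m y) / 2)" for B
  have L: "L B = residual_likelihood p x D y m B" if "0 \<le> B" for B
    unfolding L_def using that D
    by (intro residual_likelihood_eq[OF rank, symmetric] add_nonneg_pos)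
  have lim_det: "((\<lambda>B. Determinant.det (weighted_gram ?X (\<lambda>i. 1 / (B + D i)))) \<longlongrightarrow>
      Determinant.det (weighted_gram ?X (\<lambda>i. 1 / (A + D i)))) ?F"
    by (rule tendsto_det_weighted_gram[OF design_mat_carrier w])
  have lim_rss: "((\<lambda>B. weighted_rss ?X (\<lambda>i. 1 / (B + D i)) (vec m y)) \<longlongrightarrow>
      weighted_rss ?X (\<lambda>i. 1 / (A + D i)) (vec m y)) ?F"
    by (rule tendsto_weighted_rss[OF design_mat_carrier _ w]) (use det in auto)
  have "(L \<longlongrightarrow> L A) ?F"
    unfolding L_def
    by (intro tendsto_mult tendsto_exp tendsto_divide tendsto_minus tendsto_powr tendsto_prod
        tendsto_const lim lim_det lim_rss) (use det pos in force)+
  moreover have "\<forall>\<^sub>F B in ?F. L B = residual_likelihood p x D y m B"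
    unfolding eventually_at_filter by (rule always_eventually) (simp add: L)
  ultimately show "(residual_likelihood p x D y m \<longlongrightarrow> residual_likelihood p x D y m A) ?F"
    unfolding L[OF A] by (rule Lim_transform_eventually)
qed

text \<open>
  Since \<open>V\<close> grows like \<open>A\<close> times the identity, \<open>X' V\<inverse> X\<close> is \<open>1 / A\<close> times a Gram matrix whose
  weights \<open>A / (A + D i)\<close> tend to 1. The two determinants therefore contribute the powers \<open>p / 2\<close>
  and \<open>- m / 2\<close> of \<open>A\<close>, and the exponential is at most 1.
\<close>

lemma residual_likelihood_le:
  assumes rank: "vec_space.rank m (design_mat p x m) = p"
    and D: "\<And>i. i < m \<Longrightarrow> 0 < D i" and A: "0 < A"
  shows "residual_likelihood p x D y m A \<le>
    A powr ((real p - real m) / 2) *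
      Determinant.det (weighted_gram (design_mat p x m) (\<lambda>i. A / (A + D i))) powr (-1/2)"
proof -
  have pos: "0 < A + D i" if "i < m" for i using D[OF that] A by simp
  define X where "X = design_mat p x m"
  have X: "X \<in> carrier_mat m p" unfolding X_def by (rule design_mat_carrier)
  define g where "g = Determinant.det (weighted_gram X (\<lambda>i. A / (A + D i)))"
  define r where "r = weighted_rss X (\<lambda>i. 1 / (A + D i)) (vec m y)"
  have det: "0 < Determinant.det (weighted_gram X (\<lambda>i. 1 / (A + D i)))" and g: "0 < g"
    unfolding g_def using pos A by (auto intro!: det_weighted_gram_pos[OF X rank[folded X_def]])
  have "0 \<le> r"
    unfolding r_def using det pos
    by (intro weighted_rss_nonneg[OF X]) (auto simp: less_imp_le)
  have "Determinant.det (weighted_gram X (\<lambda>i. 1 / (A + D i))) = (1 / A) ^ p * g"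
    \<comment> \<open>The scaling \<open>1 / (A + D i) = 1 / A * (A / (A + D i))\<close> isolates the power of \<open>A\<close>.\<close>
    using det_weighted_gram_scale[OF X, of "1 / A" "\<lambda>i. A / (A + D i)"] A by (simp add: g_def)
  also have "\<dots> = A powr (- real p) * g"
    using A by (simp add: powr_minus powr_realpow power_one_over field_simps)
  finally have 1: "Determinant.det (weighted_gram X (\<lambda>i. 1 / (A + D i))) powr (-1/2) =
      A powr (real p / 2) * g powr (-1/2)"
    using A g by (simp add: powr_mult powr_powr)
  have "A ^ m \<le> (\<Prod>i<m. A + D i)"
    using prod_mono[of "{..<m}" "\<lambda>_. A" "\<lambda>i. A + D i"] A D by (simp add: less_imp_le)
  then have "(\<Prod>i<m. A + D i) powr (-1/2) \<le> (A ^ m) powr (-1/2)"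
    using A by (intro powr_mono2') auto
  also have "\<dots> = A powr (- real m / 2)"
    using A by (simp add: powr_powr flip: powr_realpow)
  finally have 2: "(\<Prod>i<m. A + D i) powr (-1/2) \<le> A powr (- real m / 2)" .
  have "residual_likelihood p x D y m A =
      A powr (real p / 2) * g powr (-1/2) * (\<Prod>i<m. A + D i) powr (-1/2) * exp (- r / 2)"
    unfolding r_def X_def 1[symmetric, unfolded X_def]
    by (rule residual_likelihood_eq[OF rank pos])
  also have "\<dots> \<le> A powr (real p / 2) * g powr (-1/2) * A powr (- real m / 2) * 1"
    using 2 \<open>0 \<le> r\<close> by (intro mult_mono mult_left_mono) auto
  also have "\<dots> = A powr (real p / 2 + (- real m / 2)) * g powr (-1/2)"
    by (simp only: powr_add mult_1_right mult_ac)
  also have "real p / 2 + (- real m / 2) = (real p - real m) / 2" by (simp add: diff_divide_distrib)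
  finally show ?thesis by (simp add: g_def X_def)
qed

section \<open>Existence of the maximizer\<close>

text \<open>
  The adjustment factor raises the exponent in the bound on the residual likelihood by
  \<open>(1 + z\<^sup>2) / 4\<close>, and the lower bound on \<open>m\<close> says that the sum is still negative.
\<close>

lemma NAS_objective_vanishes_at_infinity:
  assumes rank: "vec_space.rank m (design_mat p x m) = p"
    and D: "\<And>i. i < m \<Longrightarrow> 0 < D i"
    and m: "real m > real p + (1 + z\<^sup>2) / 2"
  shows "((\<lambda>A. NAS_factor z A * residual_likelihood p x D y m A) \<longlongrightarrow> 0) at_top"
proof -
  let ?X = "design_mat p x m"
  define c where "c = (1 + z\<^sup>2) / 4 + (real p - real m) / 2"
  define g where "g A = Determinant.det (weighted_gram ?X (\<lambda>i. A / (A + D i)))" for A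
  have "c < 0" using m by (simp add: c_def field_simps)
  have "((\<lambda>A::real. A / (A + D i)) \<longlongrightarrow> 1) at_top" for i by real_asymp
  then have "(g \<longlongrightarrow> Determinant.det (weighted_gram ?X (\<lambda>_. 1))) at_top"
    unfolding g_def by (intro tendsto_det_weighted_gram[OF design_mat_carrier])
  moreover have "0 < Determinant.det (weighted_gram ?X (\<lambda>_. 1))"
    by (intro det_weighted_gram_pos[OF design_mat_carrier rank]) auto
  ultimately have "((\<lambda>A. A powr c * g A powr (-1/2))
      \<longlongrightarrow> 0 * Determinant.det (weighted_gram ?X (\<lambda>_. 1)) powr (-1/2)) at_top"
    using \<open>c < 0\<close> by (intro tendsto_intros tendsto_neg_powr filterlim_ident) auto
  then have lim: "((\<lambda>A. A powr c * g A powr (-1/2)) \<longlongrightarrow> 0) at_top" by simp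
  have "\<forall>\<^sub>F A in at_top. 0 \<le> NAS_factor z A * residual_likelihood p x D y m A"
    using eventually_gt_at_top[of 0]
  proof eventually_elim
    case (elim A)
    have "0 < residual_likelihood p x D y m A"
      using D elim by (intro residual_likelihood_pos[OF rank] add_pos_pos)
    then show ?case by (simp add: NAS_factor_def)
  qed
  moreover have "\<forall>\<^sub>F A in at_top.
      NAS_factor z A * residual_likelihood p x D y m A \<le> A powr c * g A powr (-1/2)"
    using eventually_gt_at_top[of 0]
  proof eventually_elim
    case (elim A)
    have "NAS_factor z A * residual_likelihood p x D y m A \<le>
        A powr ((1 + z\<^sup>2) / 4) * (A powr ((real p - real m) / 2) * g A powr (-1/2))"
      unfolding NAS_factor_def g_def
      by (intro mult_left_mono residual_likelihood_le[OF rank D elim]) auto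
    then show ?case by (simp add: c_def powr_add)
  qed
  ultimately show ?thesis
    by (rule tendsto_sandwich[OF _ _ tendsto_const lim])
qed

lemma continuous_on_NAS_factor: "continuous_on {0..} (NAS_factor z)"
  unfolding NAS_factor_def
  by (intro continuous_on_powr' continuous_intros) (auto simp: add_pos_nonneg)

text \<open>
  Beyond some \<open>N\<close> the values stay below \<open>f 1\<close>, so a maximizer over a compact interval that contains
  \<open>1\<close> and \<open>N\<close> is global. It is not the end point \<open>0\<close>, where \<open>f\<close> vanishes.
\<close>

lemma arg_max_on_positive_reals_exists:
  fixes f :: "real \<Rightarrow> real"
  assumes cont: "continuous_on {0..} f" and zero: "f 0 = 0"
    and pos: "\<And>A. 0 < A \<Longrightarrow> 0 < f A" and lim: "(f \<longlongrightarrow> 0) at_top"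
  shows "\<exists>A. is_arg_max f (\<lambda>A. 0 < A) A"
proof -
  have "\<forall>\<^sub>F A in at_top. f A < f 1"
    by (rule order_tendstoD(2)[OF lim pos]) simp
  then obtain N where N: "\<And>A. N \<le> A \<Longrightarrow> f A < f 1" by (auto simp: eventually_at_top_linorder)
  have "\<exists>c\<in>{0..max 1 N}. \<forall>A\<in>{0..max 1 N}. f A \<le> f c"
    by (intro continuous_attains_sup continuous_on_subset[OF cont]) auto
  then obtain c where c: "0 \<le> c" "\<And>A. 0 \<le> A \<Longrightarrow> A \<le> max 1 N \<Longrightarrow> f A \<le> f c" by auto
  have "f 1 \<le> f c" using c(2)[of 1] by simp
  moreover have "0 < f 1" by (rule pos) simp
  ultimately have "0 < c" using c(1) zero by (cases "c = 0") auto
  moreover have "f A \<le> f c" if "0 < A" for A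
  proof (cases "A \<le> max 1 N")
    case True
    with that show ?thesis by (intro c(2)) auto
  next
    case False
    then have "f A < f 1" by (intro N) simp
    with \<open>f 1 \<le> f c\<close> show ?thesis by simp
  qed
  ultimately show ?thesis unfolding is_arg_max_def by (meson not_less)
qed

lemma NAS_estimator_exists:
  assumes rank: "vec_space.rank m (design_mat p x m) = p"
    and D: "\<And>i. i < m \<Longrightarrow> 0 < D i"
    and m: "real m > real p + (1 + z\<^sup>2) / 2"
  shows "\<exists>Ahat. is_NAS_estimator z p x D y m Ahat"
  unfolding is_NAS_estimator_def
proof (rule arg_max_on_positive_reals_exists)
  show "continuous_on {0..} (\<lambda>A. NAS_factor z A * residual_likelihood p x D y m A)"
    by (intro continuous_on_mult continuous_on_NAS_factor
        continuous_on_residual_likelihood[OF rank D])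
  show "NAS_factor z 0 * residual_likelihood p x D y m 0 = 0" by (simp add: NAS_factor_def)
  show "((\<lambda>A. NAS_factor z A * residual_likelihood p x D y m A) \<longlongrightarrow> 0) at_top"
    by (rule NAS_objective_vanishes_at_infinity[OF rank D m])
  fix A :: real assume "0 < A"
  then have "0 < residual_likelihood p x D y m A"
    using D by (intro residual_likelihood_pos[OF rank] add_pos_pos)
  then show "0 < NAS_factor z A * residual_likelihood p x D y m A"
    using \<open>0 < A\<close> by (simp add: NAS_factor_def)
qed

section \<open>Uniqueness for equal sampling variances\<close>

text \<open>
  With equal sampling variances all weights equal \<open>1 / (A + d)\<close>, so \<open>A\<close> enters only through a
  power of \<open>A + d\<close> and through the ordinary residual sum of squares divided by \<open>A + d\<close>.
\<close>

lemma ln_NAS_objective_balanced: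
  assumes rank: "vec_space.rank m (design_mat p x m) = p"
    and balanced: "\<And>i. i < m \<Longrightarrow> D i = d" and d: "0 < d" and A: "0 < A"
  shows "ln (NAS_factor z A * residual_likelihood p x D y m A) =
    (1 + z\<^sup>2) / 4 * ln A - (real m - real p) / 2 * ln (A + d)
      - weighted_rss (design_mat p x m) (\<lambda>_. 1) (vec m y) / 2 / (A + d)
      - ln (Determinant.det (weighted_gram (design_mat p x m) (\<lambda>_. 1))) / 2"
proof -
  define X where "X = design_mat p x m"
  have X: "X \<in> carrier_mat m p" unfolding X_def by (rule design_mat_carrier)
  define g where "g = Determinant.det (weighted_gram X (\<lambda>_. 1))"
  define S where "S = weighted_rss X (\<lambda>_. 1) (vec m y)"
  have g: "0 < g"
    unfolding g_def by (rule det_weighted_gram_pos[OF X rank[folded X_def]]) simp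
  have Ad: "0 < A + d" using A d by simp
  have w: "1 / (A + D i) = 1 / (A + d) * 1" if "i < m" for i using balanced[OF that] by simp
  have "weighted_gram X (\<lambda>i. 1 / (A + D i)) = weighted_gram X (\<lambda>i. 1 / (A + d) * 1)"
    by (rule weighted_gram_cong[OF X w])
  then have det: "Determinant.det (weighted_gram X (\<lambda>i. 1 / (A + D i))) = (1 / (A + d)) ^ p * g"
    unfolding g_def by (simp only: det_weighted_gram_scale[OF X])
  have rss: "weighted_rss X (\<lambda>i. 1 / (A + D i)) (vec m y) = 1 / (A + d) * S"
    unfolding S_def
  proof (rule trans)
    show "weighted_rss X (\<lambda>i. 1 / (A + D i)) (vec m y) =
        weighted_rss X (\<lambda>i. 1 / (A + d) * 1) (vec m y)"
      by (rule weighted_rss_cong[OF X w])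
    show "\<dots> = 1 / (A + d) * weighted_rss X (\<lambda>_. 1) (vec m y)"
      by (rule weighted_rss_scale[OF X]) (use Ad g in \<open>auto simp: g_def\<close>)
  qed
  have prod: "(\<Prod>i<m. A + D i) = (A + d) ^ m" using balanced by simp
  have "0 < A + D i" if "i < m" for i using balanced[OF that] Ad by simp
  from residual_likelihood_eq[OF rank this, where y = y]
  have "residual_likelihood p x D y m A =
      ((1 / (A + d)) ^ p * g) powr (-1/2) * ((A + d) ^ m) powr (-1/2) * exp (- (1 / (A + d) * S) / 2)"
    by (simp only: prod det[unfolded X_def] rss[unfolded X_def])
  then have "ln (NAS_factor z A * residual_likelihood p x D y m A) =
      (1 + z\<^sup>2) / 4 * ln A + (-1/2 * (real p * ln (1 / (A + d)) + ln g)
        - real m / 2 * ln (A + d) - 1 / (A + d) * S / 2)"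
    using A Ad g by (simp add: NAS_factor_def ln_mult ln_powr ln_realpow)
  also have "ln (1 / (A + d)) = - ln (A + d)" using Ad by (simp add: ln_div)
  finally show ?thesis
    by (simp add: algebra_simps diff_divide_distrib add_divide_distrib flip: X_def g_def S_def)
qed

text \<open>
  Clearing denominators in the score equation leaves a quadratic in \<open>A\<close> with negative leading
  coefficient \<open>a - n\<close> and positive constant term \<open>a * d\<^sup>2\<close>. Its roots have a negative product, so
  two positive numbers cannot both be roots unless they coincide.
\<close>

lemma score_equation_unique_root:
  fixes a n d s A B :: real
  assumes a: "0 < a" and n: "a < n" and d: "0 < d" and A: "0 < A" and B: "0 < B"
    and score_A: "a / A - n / (A + d) + s / (A + d)\<^sup>2 = 0"
    and score_B: "a / B - n / (B + d) + s / (B + d)\<^sup>2 = 0"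
  shows "A = B"
proof -
  have quad: "(a - n) * C\<^sup>2 + (2 * a * d - n * d + s) * C + a * d\<^sup>2 = 0"
    if C: "0 < C" and eq: "a / C - n / (C + d) + s / (C + d)\<^sup>2 = 0" for C
  proof -
    define E where "E = C + d"
    have "E \<noteq> 0" using C d by (simp add: E_def)
    have "0 = (a / C - n / E + s / E\<^sup>2) * (C * E\<^sup>2)" using eq by (simp add: E_def)
    also have "\<dots> = a * E\<^sup>2 - n * C * E + s * C"
      using C \<open>E \<noteq> 0\<close> by (simp add: field_simps power2_eq_square)
    finally show ?thesis by (simp add: E_def algebra_simps power2_eq_square)
  qed
  \<comment> \<open>Multiplying each root into the equation of the other one cancels the linear terms.\<close>
  have "(A - B) * ((a - n) * (A * B) - a * d\<^sup>2) =
      B * ((a - n) * A\<^sup>2 + (2 * a * d - n * d + s) * A + a * d\<^sup>2)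
      - A * ((a - n) * B\<^sup>2 + (2 * a * d - n * d + s) * B + a * d\<^sup>2)"
    by (simp add: algebra_simps power2_eq_square)
  also have "\<dots> = 0" using quad[OF A score_A] quad[OF B score_B] by simp
  finally have "(A - B) * ((a - n) * (A * B) - a * d\<^sup>2) = 0" .
  moreover have "(a - n) * (A * B) < 0" using n A B by (simp add: mult_neg_pos)
  then have "(a - n) * (A * B) - a * d\<^sup>2 \<noteq> 0" using a zero_le_power2[of d]
    by (smt (verit) mult_nonneg_nonneg)
  ultimately show ?thesis by simp
qed

lemma score_at_balanced_NAS_estimator:
  assumes rank: "vec_space.rank m (design_mat p x m) = p"
    and balanced: "\<And>i. i < m \<Longrightarrow> D i = d" and d: "0 < d"
    and est: "is_NAS_estimator z p x D y m A"
  shows "(1 + z\<^sup>2) / 4 / A - (real m - real p) / 2 / (A + d)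
    + weighted_rss (design_mat p x m) (\<lambda>_. 1) (vec m y) / 2 / (A + d)\<^sup>2 = 0"
proof -
  define a n s k where "a = (1 + z\<^sup>2) / 4" and "n = (real m - real p) / 2"
    and "s = weighted_rss (design_mat p x m) (\<lambda>_. 1) (vec m y) / 2"
    and "k = ln (Determinant.det (weighted_gram (design_mat p x m) (\<lambda>_. 1))) / 2"
  define h where "h B = a * ln B - n * ln (B + d) - s / (B + d) - k" for B
  define f where "f B = NAS_factor z B * residual_likelihood p x D y m B" for B
  have ln_f: "ln (f B) = h B" if "0 < B" for B
    unfolding f_def h_def a_def n_def s_def k_def
    by (rule ln_NAS_objective_balanced[OF rank balanced d that])
  have f_pos: "0 < f B" if "0 < B" for B
    unfolding f_def NAS_factor_def using balanced d that
    by (intro mult_pos_pos residual_likelihood_pos[OF rank]) auto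
  have A: "0 < A" and max: "\<not> (\<exists>B. 0 < B \<and> f A < f B)"
    using est by (simp_all add: is_NAS_estimator_def is_arg_max_def f_def)
  have h_max: "h B \<le> h A" if "0 < B" for B
  proof -
    have "f B \<le> f A" using max that by (meson not_less)
    then show ?thesis using f_pos[OF that] f_pos[OF A]
      by (simp flip: ln_f[OF that] ln_f[OF A])
  qed
  have "(h has_real_derivative a / A - n / (A + d) + s / (A + d)\<^sup>2) (at A)"
    unfolding h_def using A d
    by (auto intro!: derivative_eq_intros simp: power2_eq_square)
  then have "a / A - n / (A + d) + s / (A + d)\<^sup>2 = 0"
    by (rule DERIV_local_max[OF _ A]) (auto intro: h_max)
  then show ?thesis by (simp add: a_def n_def s_def)
qed

lemma balanced_NAS_estimator_unique:
  assumes rank: "vec_space.rank m (design_mat p x m) = p"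
    and balanced: "\<And>i. i < m \<Longrightarrow> D i = d" and d: "0 < d"
    and m: "real m > real p + (1 + z\<^sup>2) / 2"
    and est: "is_NAS_estimator z p x D y m A" "is_NAS_estimator z p x D y m B"
  shows "A = B"
proof -
  have score: "(1 + z\<^sup>2) / 4 / C - (real m - real p) / 2 / (C + d)
      + weighted_rss (design_mat p x m) (\<lambda>_. 1) (vec m y) / 2 / (C + d)\<^sup>2 = 0"
    if "is_NAS_estimator z p x D y m C" for C
    by (rule score_at_balanced_NAS_estimator[OF rank balanced d that])
  have "0 < (1 + z\<^sup>2) / 4" by (simp add: add_pos_nonneg)
  moreover have "(1 + z\<^sup>2) / 4 < (real m - real p) / 2" using m by (simp add: field_simps)
  moreover have "0 < A" "0 < B" using est by (auto simp: is_NAS_estimator_def is_arg_max_def)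
  moreover note score[OF est(1)] score[OF est(2)]
  ultimately show ?thesis by (rule score_equation_unique_root[OF _ _ d])
qed

theorem theorem2:
  fixes \<alpha> z :: real and p m m0 :: nat
    and x :: "nat \<Rightarrow> real Matrix.vec" and D y :: "nat \<Rightarrow> real"
  assumes alpha: "0 < \<alpha>" "\<alpha> < 1"
    and z: "measure std_normal_distribution {z<..} = \<alpha> / 2"
    and x: "\<And>i. x i \<in> carrier_vec p"
    and R1: "cond_R1 p x m0"
    and R2: "cond_R2 p x"
    and R3: "cond_R3 D"
    and R5: "cond_R5 z p x D y"
    and m0: "m \<ge> m0"
    and m: "real m > real p + (1 + z\<^sup>2) / 2"
  shows "(\<exists>Ahat. is_NAS_estimator z p x D y m Ahat) \<and>
    ((\<exists>d. \<forall>i<m. D i = d) \<longrightarrow> (\<exists>!Ahat. is_NAS_estimator z p x D y m Ahat))"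
proof -
  have rank: "vec_space.rank m (design_mat p x m) = p"
    using R1 m0 by (simp add: cond_R1_def)
  have D: "0 < D i" for i
    using R3 cINF_lower[of D UNIV i] by (auto simp: cond_R3_def)
  \<comment> \<open>A sample with at least one area makes the common sampling variance \<open>d\<close> positive.\<close>
  have "0 \<le> (1 + z\<^sup>2) / 2" by simp
  with m have "0 < real m" by linarith
  have exists: "\<exists>Ahat. is_NAS_estimator z p x D y m Ahat"
    by (rule NAS_estimator_exists[OF rank D m])
  moreover have "\<exists>!Ahat. is_NAS_estimator z p x D y m Ahat" if balanced: "\<forall>i<m. D i = d" for d
  proof -
    have "0 < d" using balanced \<open>0 < real m\<close> D[of 0] by auto
    then show ?thesis
      using exists balanced_NAS_estimator_unique[OF rank _ _ m, of D d] balanced by blast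
  qed
  ultimately show ?thesis by blast
qed

end
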